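(* Let $\mathcal C=\{\mathcal C_1,\dots,\mathcal C_K\}$ be a clustering of $\mathcal V=\{1,\dots,n\}$, and let $A=[A_{ij}]\in\mathbb R^{n\times n}$ be a stochastic matrix which has inter-cluster common influence with respect to $\mathcal C$, whose associated graph $\mathcal G(A)$ has cluster-spanning-trees with respect to $\mathcal C$, and all of whose diagonal elements are positive. Let $\alpha_1,\dots,\alpha_K$ be pairwise different real constants and let $u:\{0,1,2,\dots\}\to\mathbb R$ be a function such that both $u(t)$ and $\sum_{k=1}^{t}u(k)$ are bounded in $t$. Consider the system $$x_i(t+1)=\sum_{j=1}^n A_{ij}x_j(t)+I_i(t),\qquad I_i(t)=\alpha_p u(t)\ \text{ for } i\in\mathcal C_p,\ p=1,\dots,K,\ t\ge 0 .$$ Then for every initial condition $x(0)\in\mathbb R^n$, the solution $x(t)$ is bounded and intra-cluster synchronizes, i.e. $\lim_{t\to\infty}|x_i(t)-x_{i'}(t)|=0$ for all $i,i'\in\mathcal C_p$ and all $p=1,\dots,K$.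
   Context: A clustering of $\mathcal V=\{1,\dots,n\}$ is a partition $\mathcal C=\{\mathcal C_1,\dots,\mathcal C_K\}$ of $\mathcal V$. A stochastic matrix is a nonnegative square matrix with all row sums equal to $1$. The directed graph $\mathcal G(A)$ of a nonnegative $n\times n$ matrix $A$ has vertex set $\mathcal V$ and has an edge $(j,i)$ (from $j$ to $i$) if and only if $A_{ij}>0$. A directed graph on $\mathcal V$ has cluster-spanning-trees with respect to $\mathcal C$ if for each $p=1,\dots,K$ there is a vertex $v_p\in\mathcal V$ (not necessarily in $\mathcal C_p$) such that there are directed paths in the graph (possibly of length $0$, possibly through vertices outside $\mathcal C_p$) from $v_p$ to all vertices of $\mathcal C_p$. A stochastic matrix $A$ has inter-cluster common influence with respect to $\mathcal C$ if for every pair $p,p'$ the sum $\sum_{j\in\mathcal C_{p'}}A_{ij}$ takes the same value for all $i\in\mathcal C_p$. *)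

theory Defs
  imports "HOL-Analysis.Analysis" "HOL-Library.Disjoint_Sets"
begin

text \<open>The vertices are the elements of a finite index type, so a free type variable
  \<open>'n\<close> plays the role of the vertex set \<open>{1, \<dots>, n}\<close> with \<open>n = CARD('n)\<close>.
  The clusters are numbered, because the inputs refer to their indices; injectivity of the
  numbering makes \<open>K\<close> the number of clusters.\<close>

definition clustering :: "nat \<Rightarrow> (nat \<Rightarrow> 'n::finite set) \<Rightarrow> bool" where
  "clustering K C \<longleftrightarrow> inj_on C {1..K} \<and> partition_on UNIV (C ` {1..K})"

definition stochastic_matrix :: "real ^ 'n ^ 'n \<Rightarrow> bool" where
  "stochastic_matrix A \<longleftrightarrow>
     (\<forall>i j. A $ i $ j \<ge> 0) \<and> (\<forall>i. (\<Sum>j\<in>UNIV. A $ i $ j) = 1)"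

text \<open>A directed graph is given by its edge set; a pair \<open>(j, i)\<close> is an edge from \<open>j\<close> to \<open>i\<close>.
  Hence the reflexive transitive closure relates \<open>v\<close> to \<open>w\<close> iff there is a directed path,
  possibly of length zero, from \<open>v\<close> to \<open>w\<close>.\<close>

definition matrix_graph :: "real ^ 'n ^ 'n \<Rightarrow> ('n \<times> 'n) set" where
  "matrix_graph A = {(j, i). A $ i $ j > 0}"

definition cluster_spanning_trees ::
    "nat \<Rightarrow> (nat \<Rightarrow> 'n set) \<Rightarrow> ('n \<times> 'n) set \<Rightarrow> bool" where
  "cluster_spanning_trees K C E \<longleftrightarrow> (\<forall>p\<in>{1..K}. \<exists>v. \<forall>w\<in>C p. (v, w) \<in> E\<^sup>*)"

definition common_influence ::
    "nat \<Rightarrow> (nat \<Rightarrow> 'n set) \<Rightarrow> real ^ 'n ^ 'n \<Rightarrow> bool" where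
  "common_influence K C A \<longleftrightarrow>
     (\<forall>p\<in>{1..K}. \<forall>p'\<in>{1..K}. \<exists>c. \<forall>i\<in>C p. (\<Sum>j\<in>C p'. A $ i $ j) = c)"

definition intra_cluster_synchronizes ::
    "nat \<Rightarrow> (nat \<Rightarrow> 'n set) \<Rightarrow> (nat \<Rightarrow> real ^ 'n) \<Rightarrow> bool" where
  "intra_cluster_synchronizes K C x \<longleftrightarrow>
     (\<forall>p\<in>{1..K}. \<forall>i\<in>C p. \<forall>i'\<in>C p. (\<lambda>t. \<bar>x t $ i - x t $ i'\<bar>) \<longlonglongrightarrow> 0)"

end

theory Submission
  imports Defs
begin

text \<open>Boundedness: on the invariant subspace \<open>W = range (I - A)\<close> a fixed power of \<open>A\<close> contracts the
  maximum norm by a uniform factor \<open>\<rho> < 1\<close>. Hence \<open>I - A\<close> is injective on \<open>W\<close>, and the input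
  direction splits as \<open>c + g\<close> with \<open>A c = c\<close> and \<open>g \<in> W\<close>. The part along \<open>c\<close> only sums up the
  values of \<open>u\<close>, the part in \<open>W\<close> is damped.

  Synchronization: by common influence \<open>A\<close> preserves vectors that are constant on clusters,
  so the input does not affect differences within a cluster. A power of \<open>A\<close> has, for each
  cluster, a column whose entries in the rows of the cluster are at least \<open>\<delta> > 0\<close>, namely the
  column of the root; it shrinks the largest difference within a cluster by the factor
  \<open>1 - \<delta>\<close>.\<close>

section \<open>Matrix powers, the maximum norm and stochastic matrices\<close>

primrec mat_power :: "real ^ 'n::finite ^ 'n \<Rightarrow> nat \<Rightarrow> real ^ 'n ^ 'n" where
  "mat_power A 0 = mat 1"
| "mat_power A (Suc k) = A ** mat_power A k"

lemma mat_power_Suc_mult: "mat_power A (Suc k) *v w = A *v (mat_power A k *v w)"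
  by (simp add: matrix_vector_mul_assoc)

lemma matrix_vector_mult_nth: "(A *v w) $ i = (\<Sum>j\<in>UNIV. A $ i $ j * w $ j)"
  by (simp add: matrix_vector_mult_def)

lemma infnorm_le_iff: "infnorm (w :: real ^ 'n::finite) \<le> b \<longleftrightarrow> (\<forall>i. \<bar>w $ i\<bar> \<le> b)"
proof
  assume "infnorm w \<le> b"
  then show "\<forall>i. \<bar>w $ i\<bar> \<le> b"
    using component_le_infnorm_cart order_trans by blast
next
  assume "\<forall>i. \<bar>w $ i\<bar> \<le> b"
  then show "infnorm w \<le> b"
    unfolding infnorm_cart by (intro cSup_least) auto
qed

lemma infnorm_attained: "\<exists>i. \<bar>w $ i\<bar> = infnorm (w :: real ^ 'n::finite)"
proof -
  have "infnorm w = Sup (range (\<lambda>i. \<bar>w $ i\<bar>))"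
    unfolding infnorm_cart by (rule arg_cong[where f = Sup]) auto
  also have "\<dots> = Max (range (\<lambda>i. \<bar>w $ i\<bar>))"
    by (intro cSup_eq_Max) auto
  also have "\<dots> \<in> range (\<lambda>i. \<bar>w $ i\<bar>)"
    by (intro Max_in) auto
  finally show ?thesis by auto
qed

lemma stochastic_matrix_nonneg: "stochastic_matrix A \<Longrightarrow> A $ i $ j \<ge> 0"
  and stochastic_matrix_row_sum: "stochastic_matrix A \<Longrightarrow> (\<Sum>j\<in>UNIV. A $ i $ j) = 1"
  by (auto simp: stochastic_matrix_def)

lemma stochastic_matrix_mult_le:
  assumes "stochastic_matrix A" and "\<And>j. w $ j \<le> M"
  shows "(A *v w) $ i \<le> M"
proof -
  have "(A *v w) $ i \<le> (\<Sum>j\<in>UNIV. A $ i $ j * M)"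
    unfolding matrix_vector_mult_nth
    by (intro sum_mono mult_left_mono assms stochastic_matrix_nonneg)
  also have "\<dots> = M"
    using stochastic_matrix_row_sum[OF assms(1)] by (simp flip: sum_distrib_right)
  finally show ?thesis .
qed

text \<open>Each entry of the image is a convex combination of the entries of \<open>w\<close>. The
  one-sided bound applied to \<open>w\<close> and to \<open>- w\<close> gives both signs.\<close>

lemma infnorm_stochastic_mult_le:
  assumes "stochastic_matrix A"
  shows "infnorm (A *v w) \<le> infnorm w"
proof -
  have "(A *v w) $ i \<le> infnorm w" for i
    by (rule stochastic_matrix_mult_le[OF assms]) (use component_le_infnorm_cart[of w] abs_le_D1 in blast)
  moreover have "(A *v (- w)) $ i \<le> infnorm w" for i
    by (rule stochastic_matrix_mult_le[OF assms])
      (use component_le_infnorm_cart[of w] abs_le_D2 in auto)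
  moreover have "A *v (- w) = - (A *v w)"
    by (simp add: vec_eq_iff matrix_vector_mult_nth sum_negf)
  ultimately show ?thesis
    by (simp add: infnorm_le_iff abs_le_iff)
qed

lemma stochastic_matrix_mult:
  assumes "stochastic_matrix A" "stochastic_matrix B"
  shows "stochastic_matrix (A ** B)"
  unfolding stochastic_matrix_def
proof (intro conjI allI)
  show "(A ** B) $ i $ j \<ge> 0" for i j
    using assms by (auto simp: matrix_matrix_mult_def stochastic_matrix_nonneg intro!: sum_nonneg)
  fix i
  have "(\<Sum>j\<in>UNIV. (A ** B) $ i $ j) = (\<Sum>k\<in>UNIV. A $ i $ k * (\<Sum>j\<in>UNIV. B $ k $ j))"
    unfolding matrix_matrix_mult_def by (simp add: sum_distrib_left) (rule sum.swap)
  then show "(\<Sum>j\<in>UNIV. (A ** B) $ i $ j) = 1"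
    using assms by (simp add: stochastic_matrix_row_sum)
qed

lemma stochastic_mat_power:
  assumes "stochastic_matrix A"
  shows "stochastic_matrix (mat_power A k)"
proof (induction k)
  case 0
  show ?case by (simp add: stochastic_matrix_def mat_def)
next
  case (Suc k)
  then show ?case using assms by (simp add: stochastic_matrix_mult)
qed

section \<open>Stochastic matrices on the range of \<open>I - A\<close>\<close>

text \<open>A weighted average attains the upper bound only if every entry of positive weight does:
  the nonnegative terms \<open>A $ i $ j * (M - w $ j)\<close> sum to zero, so each of them
  vanishes.\<close>

lemma stochastic_row_extremal:
  assumes A: "stochastic_matrix A" and le: "\<And>j. w $ j \<le> M" and eq: "(A *v w) $ i = M"
    and pos: "A $ i $ j > 0"
  shows "w $ j = M"
proof -
  have "(\<Sum>j\<in>UNIV. A $ i $ j * (M - w $ j)) = M * (\<Sum>j\<in>UNIV. A $ i $ j) - (A *v w) $ i"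
    by (simp add: matrix_vector_mult_nth right_diff_distrib sum_subtractf sum_distrib_left mult.commute)
  also have "\<dots> = 0"
    using eq stochastic_matrix_row_sum[OF A] by simp
  finally have "\<forall>j\<in>UNIV. A $ i $ j * (M - w $ j) = 0"
    using A le by (subst (asm) sum_nonneg_eq_0_iff) (auto simp: stochastic_matrix_nonneg)
  then show ?thesis using pos by force
qed

text \<open>Take a minimizer \<open>i\<close> of \<open>z\<close> over \<open>S\<close>. All the
  weight of row \<open>i\<close> lies inside \<open>S\<close>, so the average
  \<open>(A *v z) $ i\<close> is at least \<open>z $ i\<close>, against the assumed sign.\<close>

lemma no_closed_set_with_positive_drift:
  assumes A: "stochastic_matrix A" and "S \<noteq> {}"
    and closed: "\<And>i j. i \<in> S \<Longrightarrow> A $ i $ j > 0 \<Longrightarrow> j \<in> S"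
    and pos: "\<And>i. i \<in> S \<Longrightarrow> (z - A *v z) $ i > 0"
  shows False
proof -
  obtain i where i: "i \<in> S" and min: "\<And>j. j \<in> S \<Longrightarrow> z $ i \<le> z $ j"
    using \<open>S \<noteq> {}\<close> ex_is_arg_min_if_finite[of S "\<lambda>i. z $ i"]
    by (auto simp: is_arg_min_def not_less)
  have "A $ i $ j * z $ i \<le> A $ i $ j * z $ j" for j
  proof (cases "A $ i $ j > 0")
    case True
    then show ?thesis using closed[OF i] min by simp
  next
    case False
    then have "A $ i $ j = 0" using stochastic_matrix_nonneg[OF A, of i j] by simp
    then show ?thesis by simp
  qed
  then have "(\<Sum>j\<in>UNIV. A $ i $ j * z $ i) \<le> (A *v z) $ i"
    unfolding matrix_vector_mult_nth by (intro sum_mono)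
  moreover have "(\<Sum>j\<in>UNIV. A $ i $ j * z $ i) = z $ i"
    using stochastic_matrix_row_sum[OF A] by (simp flip: sum_distrib_right)
  ultimately show False using pos[OF i] by simp
qed

text \<open>Each strict inclusion removes at least one element, so \<open>N\<close> strict steps
  would exhaust a set of at most \<open>N\<close> elements and leave \<open>T N\<close>
  empty.\<close>

lemma decreasing_sets_stationary:
  assumes fin: "finite (T 0)" and dec: "\<And>k. k < N \<Longrightarrow> T (Suc k) \<subseteq> T k"
    and card: "card (T 0) \<le> N" and ne: "T N \<noteq> {}"
  shows "\<exists>k<N. T (Suc k) = T k"
proof (rule ccontr)
  assume "\<not> ?thesis"
  then have strict: "T (Suc k) \<subset> T k" if "k < N" for k
    using dec that by blast
  have "k \<le> N \<Longrightarrow> finite (T k) \<and> card (T k) + k \<le> N" for k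
  proof (induction k)
    case 0
    then show ?case using fin card by simp
  next
    case (Suc k)
    then have "T (Suc k) \<subset> T k" "finite (T k)" "card (T k) + k \<le> N" using strict by auto
    then show ?case using psubset_card_mono[of "T k" "T (Suc k)"] finite_subset[of "T (Suc k)" "T k"]
      by auto
  qed
  from this[of N] show False using ne by auto
qed

text \<open>\<open>A\<close> commutes with \<open>I - A\<close>, hence the range is
  invariant.\<close>

lemma mat_power_in_range:
  assumes "w \<in> range (\<lambda>z. z - A *v z)"
  shows "mat_power A k *v w \<in> range (\<lambda>z. z - A *v z)"
proof (induction k)
  case 0
  then show ?case using assms by simp
next
  case (Suc k)
  then obtain z where "mat_power A k *v w = z - A *v z" by auto
  then have "mat_power A (Suc k) *v w = A *v z - A *v (A *v z)"
    by (simp only: mat_power_Suc_mult matrix_vector_mult_diff_distrib)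
  then show ?case by auto
qed

lemma mat_power_infnorm_decreasing:
  assumes "stochastic_matrix A" and "k \<le> l"
  shows "infnorm (mat_power A l *v w) \<le> infnorm (mat_power A k *v w)"
  using assms(2)
proof (induction l rule: dec_induct)
  case (step l)
  then show ?case
    using infnorm_stochastic_mult_le[OF assms(1), of "mat_power A l *v w"]
    by (simp only: mat_power_Suc_mult)
qed simp

text \<open>The pairs \<open>(i, s)\<close> of a position and a sign at which the orbit of \<open>w\<close> has extremal value
  form a decreasing sequence of sets because the diagonal is positive. If the norm is preserved
  for long enough, the sequence is stationary at some step; the positions of a fixed sign
  are then a closed set of vertices on which \<open>z - A *v z\<close> is constant and nonzero.\<close>

lemma strict_contraction_on_range:
  fixes A :: "real ^ 'n::finite ^ 'n"
  assumes A: "stochastic_matrix A" and diag: "\<And>i. A $ i $ i > 0"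
    and w: "w \<in> range (\<lambda>z. z - A *v z)" and "w \<noteq> 0"
  shows "infnorm (mat_power A (2 * CARD('n)) *v w) < infnorm w"
proof (rule ccontr)
  \<comment> \<open>\<open>N\<close> counts the pairs of a position and a sign, which bounds the
    length of a strictly decreasing sequence of sets of such pairs.\<close>
  define N where "N = 2 * CARD('n)"
  define M where "M = infnorm w"
  define y where "y k = mat_power A k *v w" for k
  assume "\<not> ?thesis"
  then have N: "infnorm (y N) \<ge> M" by (simp add: N_def M_def y_def)
  have y0: "y 0 = w" and ySuc: "\<And>k. y (Suc k) = A *v y k"
    by (simp add: y_def, simp only: y_def mat_power_Suc_mult)
  \<comment> \<open>Norms never increase along the orbit, so a norm of at least \<open>M\<close> at
    step \<open>N\<close> forces equality at every earlier step.\<close>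
  have norm_y: "infnorm (y k) = M" if "k \<le> N" for k
    using mat_power_infnorm_decreasing[OF A, of 0 k w] mat_power_infnorm_decreasing[OF A that, of w]
      N by (simp add: y_def M_def)
  have "M > 0" using \<open>w \<noteq> 0\<close> by (simp add: M_def infnorm_pos_lt)
  define T where "T k = {(i, s). s \<in> {1, -1} \<and> (s *\<^sub>R y k) $ i = M}" for k
  have T_sub: "T k \<subseteq> UNIV \<times> {1, -1}" for k by (auto simp: T_def)
  have extremal: "(j, s) \<in> T k"
    if "k < N" and "(i, s) \<in> T (Suc k)" and "A $ i $ j > 0" for i j s k
  proof -
    have s: "s = 1 \<or> s = -1" using that by (auto simp: T_def)
    have "(s *\<^sub>R y k) $ j \<le> M" for j
      using s component_le_infnorm_cart[of "y k" j] norm_y[of k] that(1) by auto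
    moreover have "(A *v (s *\<^sub>R y k)) $ i = M"
      using that(2) by (simp add: T_def ySuc matrix_vector_mult_scaleR)
    ultimately have "(s *\<^sub>R y k) $ j = M"
      using stochastic_row_extremal[OF A _ _ that(3)] by blast
    then show ?thesis using s by (auto simp: T_def)
  qed
  have "\<exists>k<N. T (Suc k) = T k"
  proof (rule decreasing_sets_stationary)
    show "finite (T 0)" using T_sub finite_subset by fastforce
    show "T (Suc k) \<subseteq> T k" if "k < N" for k
      using extremal[OF that] diag by auto
    have "card (T 0) \<le> card ((UNIV :: 'n set) \<times> {1, -1 :: real})"
      by (rule card_mono[OF _ T_sub]) auto
    then show "card (T 0) \<le> N" by (simp add: N_def card_cartesian_product)
    obtain i where "\<bar>y N $ i\<bar> = M" using infnorm_attained[of "y N"] norm_y[of N] by auto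
    then have "(i, 1) \<in> T N \<or> (i, -1) \<in> T N" by (auto simp: T_def)
    then show "T N \<noteq> {}" by auto
  qed
  then obtain k where k: "k < N" and stat: "T (Suc k) = T k" by auto
  obtain i where "\<bar>y k $ i\<bar> = M" using infnorm_attained[of "y k"] norm_y[of k] k by auto
  then have "(i, 1) \<in> T k \<or> (i, -1) \<in> T k" by (auto simp: T_def)
  then obtain s where s: "(i, s) \<in> T k" by auto
  obtain z where z: "y k = z - A *v z"
    using mat_power_in_range[OF w, of k] by (auto simp: y_def)
  show False
  \<comment> \<open>Closedness comes from \<open>extremal\<close> together with the stationarity of
    \<open>T\<close> at \<open>k\<close>. Multiplying by the sign \<open>s\<close> makes the drift
    equal to \<open>M > 0\<close> on the whole set.\<close>
  proof (rule no_closed_set_with_positive_drift[OF A, of "{j. (j, s) \<in> T k}" "s *\<^sub>R z"])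
    show "{j. (j, s) \<in> T k} \<noteq> {}" using s by auto
    show "j' \<in> {j. (j, s) \<in> T k}" if "j \<in> {j. (j, s) \<in> T k}" "A $ j $ j' > 0" for j j'
      using extremal[OF k, of j s j'] that stat by auto
    show "(s *\<^sub>R z - A *v (s *\<^sub>R z)) $ j > 0" if "j \<in> {j. (j, s) \<in> T k}" for j
    proof -
      have "s *\<^sub>R z - A *v (s *\<^sub>R z) = s *\<^sub>R y k"
        by (simp add: z matrix_vector_mult_scaleR scaleR_diff_right)
      then show ?thesis using that \<open>M > 0\<close> by (simp add: T_def)
    qed
  qed
qed

lemma subspace_range_drift: "subspace (range (\<lambda>z. z - A *v z :: real ^ 'n::finite))"
proof -
  have "linear (\<lambda>z. z - A *v z)"
    by (intro linear_compose_sub linear_ident matrix_vector_mul_linear)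
  then show ?thesis by (rule linear_subspace_image) simp
qed

text \<open>The unit sphere of the range is compact, so the strict contraction attains a largest
  factor there, which is still below 1. Homogeneity carries the factor over to the whole
  range.\<close>

lemma uniform_contraction_on_range:
  fixes A :: "real ^ 'n::finite ^ 'n"
  assumes A: "stochastic_matrix A" and diag: "\<And>i. A $ i $ i > 0"
  obtains \<rho> where "0 \<le> \<rho>" "\<rho> < 1"
    "\<And>w. w \<in> range (\<lambda>z. z - A *v z) \<Longrightarrow>
      infnorm (mat_power A (2 * CARD('n)) *v w) \<le> \<rho> * infnorm w"
proof -
  define W where "W = range (\<lambda>z. z - A *v z)"
  define P where "P = mat_power A (2 * CARD('n))"
  define S where "S = W \<inter> {w. infnorm w = 1}"
  have W: "subspace W" unfolding W_def by (rule subspace_range_drift)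
  have "closed {w :: real ^ 'n. infnorm w = 1}"
    by (intro closed_Collect_eq continuous_intros continuous_on_infnorm)
  moreover have "bounded {w :: real ^ 'n. infnorm w = 1}"
    unfolding bounded_iff using norm_le_infnorm[where 'a = "real ^ 'n"]
    by (metis mem_Collect_eq mult.right_neutral)
  ultimately have "compact S"
    unfolding S_def by (intro closed_Int_compact closed_subspace[OF W]) (simp add: compact_eq_bounded_closed)
  have cont: "continuous_on S (\<lambda>w. infnorm (P *v w))"
    by (intro continuous_on_infnorm matrix_vector_mult_linear_continuous_on)
  show thesis
  proof (cases "S = {}")
    \<comment> \<open>An empty sphere means that the range is trivial, as for the identity matrix;
      the factor 0 then serves.\<close>
    case True
    have "w = 0" if "w \<in> W" for w
    proof (rule ccontr)
      assume "w \<noteq> 0"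
      then have "(1 / infnorm w) *\<^sub>R w \<in> S"
        using that W by (auto simp: S_def subspace_scale infnorm_mul infnorm_pos_le infnorm_eq_0)
      then show False using True by auto
    qed
    then have "W = {0}" using subspace_0[OF W] by blast
    then have "infnorm (mat_power A (2 * CARD('n)) *v w) \<le> 0 * infnorm w" if "w \<in> W" for w
      using that by (simp add: infnorm_0)
    then show thesis using that[of 0] by (simp add: W_def)
  next
    case False
    then obtain w0 where w0: "w0 \<in> S" and max: "\<And>w. w \<in> S \<Longrightarrow> infnorm (P *v w) \<le> infnorm (P *v w0)"
      using continuous_attains_sup[OF \<open>compact S\<close> _ cont] by auto
    show thesis
    proof (rule that[of "infnorm (P *v w0)"])
      have "w0 \<noteq> 0" using w0 by (auto simp: S_def infnorm_0)
      then show "infnorm (P *v w0) < 1"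
        using strict_contraction_on_range[OF A diag, of w0] w0 by (auto simp: S_def W_def P_def)
      show "infnorm (mat_power A (2 * CARD('n)) *v w) \<le> infnorm (P *v w0) * infnorm w"
        if "w \<in> range (\<lambda>z. z - A *v z)" for w
      proof (cases "w = 0")
        case False
        then have pos: "infnorm w > 0" by (simp add: infnorm_pos_lt)
        then have "(1 / infnorm w) *\<^sub>R w \<in> S"
          using that W by (auto simp: S_def W_def subspace_scale infnorm_mul)
        from max[OF this] show ?thesis
          using pos by (simp add: P_def matrix_vector_mult_scaleR infnorm_mul field_simps)
      qed (simp add: infnorm_0)
    qed (rule infnorm_pos_le)
  qed
qed

text \<open>A nonzero fixed vector in the range would contradict strict contraction. Hence
  \<open>I - A\<close> is injective on its range, and by dimension it maps the range onto itself. So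
  some \<open>g\<close> in the range has the same image as \<open>\<zeta>\<close>, and the
  difference \<open>\<zeta> - g\<close> is fixed by \<open>A\<close>.\<close>

lemma fixed_plus_range_decomposition:
  fixes A :: "real ^ 'n::finite ^ 'n"
  assumes A: "stochastic_matrix A" and diag: "\<And>i. A $ i $ i > 0"
  obtains c g where "\<zeta> = c + g" "A *v c = c" "g \<in> range (\<lambda>z. z - A *v z)"
proof -
  define L where "L = (\<lambda>z. z - A *v z)"
  define W where "W = range L"
  have W: "subspace W" unfolding W_def L_def by (rule subspace_range_drift)
  have lin: "linear L" unfolding L_def
    by (intro linear_compose_sub linear_ident matrix_vector_mul_linear)
  have "w = 0" if "w \<in> W" "L w = 0" for w
  proof (rule ccontr)
    assume "w \<noteq> 0"
    have "A *v w = w" using that(2) by (simp add: L_def)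
    have "mat_power A k *v w = w" for k
    proof (induction k)
      case (Suc k)
      then show ?case using \<open>A *v w = w\<close> by (simp only: mat_power_Suc_mult)
    qed simp
    then show False
      using strict_contraction_on_range[OF A diag _ \<open>w \<noteq> 0\<close>] that(1) by (simp add: W_def L_def)
  qed
  then have inj: "inj_on L W"
    using linear_injective_on_subspace_0[OF lin W] by blast
  have "L ` W = W"
  proof (rule subspace_dim_equal)
    show "subspace (L ` W)" using lin W by (rule linear_subspace_image)
    show "subspace W" by (rule W)
    show "L ` W \<subseteq> W" by (auto simp: W_def)
    have "dim (L ` W) = dim W"
      using lin inj W by (intro dim_image_eq) (auto simp: span_eq_iff[THEN iffD2])
    then show "dim (L ` W) \<ge> dim W" by simp
  qed
  moreover have "L \<zeta> \<in> W" by (simp add: W_def)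
  ultimately obtain g where g: "g \<in> W" "L g = L \<zeta>" by (metis imageE)
  then have "A *v (\<zeta> - g) = \<zeta> - g"
    by (simp add: L_def matrix_vector_mult_diff_distrib algebra_simps)
  with g show thesis using that[of "\<zeta> - g" g] by (simp add: W_def L_def)
qed

section \<open>Boundedness of the driven system\<close>

text \<open>Contraction is available only over blocks of \<open>m\<close> steps. Within the first
  block the linear growth bound is enough; later the claim for \<open>t\<close> follows from that
  for \<open>t - m\<close>.\<close>

lemma contracting_recursion_bounded:
  fixes a :: "nat \<Rightarrow> real"
  assumes m: "m > 0" and \<rho>: "0 \<le> \<rho>" "\<rho> < 1" and b: "b \<ge> 0" and a0: "a 0 \<ge> 0"
    and step: "\<And>t. a (Suc t) \<le> a t + b" and contr: "\<And>t. a (t + m) \<le> \<rho> * a t + b * m"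
  shows "a t \<le> a 0 + b * m / (1 - \<rho>)"
proof (induction t rule: less_induct)
  case (less t)
  \<comment> \<open>The fixed point of the affine map with slope \<open>\<rho>\<close> and offset
    \<open>b * m\<close>, raised by \<open>a 0\<close>; since \<open>a 0\<close> is nonnegative, the
    map does not increase \<open>X\<close>.\<close>
  define X where "X = a 0 + b * m / (1 - \<rho>)"
  have le: "b * m \<le> b * m / (1 - \<rho>)"
    using \<rho> b by (simp add: pos_le_divide_eq mult_left_le)
  show ?case
  proof (cases "t < m")
    case True
    have "a t \<le> a 0 + b * t"
    proof (induction t)
      case (Suc t)
      then show ?case using step[of t] by (simp add: algebra_simps)
    qed simp
    also have "\<dots> \<le> a 0 + b * m" using True b by (simp add: mult_left_mono)
    finally show ?thesis using le by simp
  next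
    case False
    then have "a t \<le> \<rho> * a (t - m) + b * m" using contr[of "t - m"] by simp
    also have "\<dots> \<le> \<rho> * X + b * m"
      using less[of "t - m"] False m \<rho> by (auto simp: X_def intro: mult_left_mono)
    also have "\<dots> \<le> X"
    proof -
      have "(1 - \<rho>) * X = (1 - \<rho>) * a 0 + b * m" using \<rho> by (simp add: X_def distrib_left)
      moreover have "(1 - \<rho>) * a 0 \<ge> 0" using \<rho> a0 by simp
      ultimately show ?thesis by (simp add: algebra_simps)
    qed
    finally show ?thesis by (simp add: X_def)
  qed
qed

text \<open>The state never leaves the invariant range. Over \<open>m\<close> steps the free motion
  shrinks by \<open>\<rho>\<close>, while the inputs add at most \<open>b * m\<close> because
  \<open>A\<close> does not expand the maximum norm.\<close>

lemma driven_system_on_range_bounded: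
  fixes A :: "real ^ 'n::finite ^ 'n"
  assumes A: "stochastic_matrix A" and diag: "\<And>i. A $ i $ i > 0"
    and g: "g \<in> range (\<lambda>z. z - A *v z)" and u: "bounded (range u)"
    and s0: "s 0 = 0" and s: "\<And>t. s (Suc t) = A *v s t + u t *\<^sub>R g"
  obtains B where "\<And>t. infnorm (s t) \<le> B"
proof -
  define W where "W = range (\<lambda>z. z - A *v z)"
  have W: "subspace W" unfolding W_def by (rule subspace_range_drift)
  define m where "m = 2 * CARD('n)"
  have sW: "s t \<in> W" for t
  proof (induction t)
    case 0
    then show ?case using W s0 by (simp add: subspace_0)
  next
    case (Suc t)
    then have "A *v s t \<in> W"
      using mat_power_in_range[of "s t" A 1] by (simp add: W_def)
    then show ?case using W g by (simp add: s W_def subspace_add subspace_scale)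
  qed
  obtain U where U: "\<And>t. \<bar>u t\<bar> \<le> U" using u by (auto simp: bounded_iff)
  define b where "b = U * infnorm g"
  have input: "infnorm (u t *\<^sub>R g) \<le> b" for t
    using U by (simp add: b_def infnorm_mul mult_right_mono infnorm_pos_le)
  have b: "b \<ge> 0" using input[of 0] infnorm_pos_le order_trans by blast
  \<comment> \<open>The distance between the driven and the free motion grows by at most one input
    of norm \<open>b\<close> per step.\<close>
  have dev: "infnorm (s (t + k) - mat_power A k *v s t) \<le> b * k" for t k
  proof (induction k)
    case (Suc k)
    have "s (t + Suc k) - mat_power A (Suc k) *v s t
        = A *v (s (t + k) - mat_power A k *v s t) + u (t + k) *\<^sub>R g"
      by (simp only: s add_Suc_right mat_power_Suc_mult matrix_vector_mult_diff_distrib) simp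
    then have "infnorm (s (t + Suc k) - mat_power A (Suc k) *v s t)
        \<le> infnorm (A *v (s (t + k) - mat_power A k *v s t)) + infnorm (u (t + k) *\<^sub>R g)"
      by (simp only: infnorm_triangle)
    also have "\<dots> \<le> b * k + b"
      using Suc infnorm_stochastic_mult_le[OF A] input by (intro add_mono) (auto intro: order_trans)
    finally show ?case by (simp add: algebra_simps)
  qed (simp add: infnorm_0)
  have near: "infnorm (s (t + k)) \<le> infnorm (mat_power A k *v s t) + b * k" for t k
    using infnorm_triangle[of "mat_power A k *v s t" "s (t + k) - mat_power A k *v s t"] dev[of t k]
    by simp
  obtain \<rho> where \<rho>: "0 \<le> \<rho>" "\<rho> < 1"
    and contr: "\<And>w. w \<in> W \<Longrightarrow> infnorm (mat_power A m *v w) \<le> \<rho> * infnorm w"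
    using uniform_contraction_on_range[OF A diag] by (auto simp: W_def m_def)
  have "infnorm (s t) \<le> infnorm (s 0) + b * m / (1 - \<rho>)" for t
  proof (rule contracting_recursion_bounded[OF _ \<rho> b, of m "\<lambda>t. infnorm (s t)"])
    show "m > 0" by (simp add: m_def)
    show "infnorm (s (Suc t)) \<le> infnorm (s t) + b" for t
      using near[of t 1] infnorm_stochastic_mult_le[OF A, of "s t"] by simp
    show "infnorm (s (t + m)) \<le> \<rho> * infnorm (s t) + b * m" for t
      using near[of t m] contr[OF sW, of t] by simp
  qed (simp add: infnorm_pos_le)
  then show thesis by (rule that)
qed

lemma driven_system_bounded:
  fixes A :: "real ^ 'n::finite ^ 'n"
  assumes A: "stochastic_matrix A" and diag: "\<And>i. A $ i $ i > 0"
    and u: "bounded (range u)" and sum_u: "bounded (range (\<lambda>t. \<Sum>k<t. u k))"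
    and x: "\<And>t. x (Suc t) = A *v x t + u t *\<^sub>R \<zeta>"
  shows "bounded (range x)"
proof -
  obtain c g where \<zeta>: "\<zeta> = c + g" and c: "A *v c = c" and g: "g \<in> range (\<lambda>z. z - A *v z)"
    using fixed_plus_range_decomposition[OF A diag] by blast
  \<comment> \<open>Removing the free motion and the accumulated input along the fixed vector
    \<open>c\<close> leaves a system that starts at zero and is driven along \<open>g\<close>
    alone.\<close>
  define s where "s t = x t - mat_power A t *v x 0 - (\<Sum>k<t. u k) *\<^sub>R c" for t
  have s0: "s 0 = 0" by (simp add: s_def)
  have s: "s (Suc t) = A *v s t + u t *\<^sub>R g" for t
    unfolding s_def mat_power_Suc_mult
    by (simp add: x \<zeta> c matrix_vector_mult_diff_distrib matrix_vector_mult_scaleR algebra_simps)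
  obtain B where B: "\<And>t. infnorm (s t) \<le> B"
    using driven_system_on_range_bounded[OF A diag g u s0 s] by blast
  obtain V where V: "\<And>t. \<bar>\<Sum>k<t. u k\<bar> \<le> V" using sum_u by (auto simp: bounded_iff)
  have bound: "infnorm (x t) \<le> B + infnorm (x 0) + V * infnorm c" for t
  proof -
    have "x t = s t + mat_power A t *v x 0 + (\<Sum>k<t. u k) *\<^sub>R c" by (simp add: s_def)
    then have "infnorm (x t)
        \<le> infnorm (s t) + infnorm (mat_power A t *v x 0) + infnorm ((\<Sum>k<t. u k) *\<^sub>R c)"
      using infnorm_triangle[of "s t + mat_power A t *v x 0" "(\<Sum>k<t. u k) *\<^sub>R c"]
        infnorm_triangle[of "s t" "mat_power A t *v x 0"] by simp
    moreover have "infnorm ((\<Sum>k<t. u k) *\<^sub>R c) \<le> V * infnorm c"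
      using V by (simp add: infnorm_mul mult_right_mono infnorm_pos_le)
    moreover have "infnorm (mat_power A t *v x 0) \<le> infnorm (x 0)"
      by (rule infnorm_stochastic_mult_le[OF stochastic_mat_power[OF A]])
    ultimately show ?thesis using B[of t] by linarith
  qed
  have "norm (x t) \<le> sqrt DIM(real ^ 'n) * (B + infnorm (x 0) + V * infnorm c)" for t
    using norm_le_infnorm[of "x t"] bound[of t] mult_left_mono[OF bound[of t], of "sqrt DIM(real ^ 'n)"]
    by (meson order_trans real_sqrt_ge_zero of_nat_0_le_iff)
  then show ?thesis unfolding bounded_iff by auto
qed

section \<open>Synchronization\<close>

definition cluster_constant :: "nat \<Rightarrow> (nat \<Rightarrow> 'n set) \<Rightarrow> real ^ 'n \<Rightarrow> bool" where
  "cluster_constant K C h \<longleftrightarrow> (\<forall>p\<in>{1..K}. \<forall>i\<in>C p. \<forall>i'\<in>C p. h $ i = h $ i')"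

text \<open>One bound \<open>D\<close> is shared by all clusters, because \<open>A\<close> mixes
  them and no cluster can be estimated on its own.\<close>

definition cluster_diameter_le :: "nat \<Rightarrow> (nat \<Rightarrow> 'n set) \<Rightarrow> real ^ 'n \<Rightarrow> real \<Rightarrow> bool" where
  "cluster_diameter_le K C h D \<longleftrightarrow> (\<forall>p\<in>{1..K}. \<forall>i\<in>C p. \<forall>i'\<in>C p. \<bar>h $ i - h $ i'\<bar> \<le> D)"

lemma cluster_constant_add:
  assumes "cluster_constant K C g" "cluster_constant K C h"
  shows "cluster_constant K C (g + h)"
  unfolding cluster_constant_def
proof (intro ballI)
  fix p i i' assume "p \<in> {1..K}" "i \<in> C p" "i' \<in> C p"
  then have "g $ i = g $ i'" "h $ i = h $ i'"
    using assms unfolding cluster_constant_def by blast+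
  then show "(g + h) $ i = (g + h) $ i'" by simp
qed

lemma cluster_diameter_le_add_cluster_constant:
  assumes "cluster_diameter_le K C h D" "cluster_constant K C g"
  shows "cluster_diameter_le K C (h + g) D"
  unfolding cluster_diameter_le_def
proof (intro ballI)
  fix p i i' assume "p \<in> {1..K}" "i \<in> C p" "i' \<in> C p"
  then have "g $ i = g $ i'" "\<bar>h $ i - h $ i'\<bar> \<le> D"
    using assms unfolding cluster_constant_def cluster_diameter_le_def by blast+
  then show "\<bar>(h + g) $ i - (h + g) $ i'\<bar> \<le> D" by simp
qed

lemma clustering_ex: "clustering K C \<Longrightarrow> \<exists>p\<in>{1..K}. i \<in> C p"
proof -
  assume "clustering K C"
  then have "\<Union> (C ` {1..K}) = UNIV" unfolding clustering_def partition_on_def by blast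
  then show ?thesis by blast
qed

lemma clustering_unique:
  assumes "clustering K C" "p \<in> {1..K}" "q \<in> {1..K}" "i \<in> C p" "i \<in> C q"
  shows "p = q"
proof (rule ccontr)
  assume "p \<noteq> q"
  then have "C p \<noteq> C q"
    using assms(1-3) unfolding clustering_def by (auto dest: inj_onD)
  moreover have "disjoint (C ` {1..K})"
    using assms(1) unfolding clustering_def partition_on_def by blast
  ultimately have "C p \<inter> C q = {}"
    using assms(2,3) disjointD by (metis imageI)
  then show False using assms(4,5) by blast
qed

text \<open>Used twice: for the vector of cluster minima and for the input direction with entries
  \<open>\<alpha> p\<close>.\<close>

lemma clustering_vector:
  fixes C :: "nat \<Rightarrow> 'n::finite set"
  assumes "clustering K C"
  obtains h :: "real ^ 'n" where "\<And>p i. p \<in> {1..K} \<Longrightarrow> i \<in> C p \<Longrightarrow> h $ i = f p"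
proof -
  define cl where "cl i = (SOME p. p \<in> {1..K} \<and> i \<in> C p)" for i
  have cl: "cl i \<in> {1..K} \<and> i \<in> C (cl i)" for i
    unfolding cl_def by (rule someI_ex) (use clustering_ex[OF assms, of i] in blast)
  have "(\<chi> i. f (cl i)) $ i = f p" if "p \<in> {1..K}" "i \<in> C p" for p i
    using clustering_unique[OF assms that(1) _ that(2)] cl[of i] by auto
  then show thesis by (rule that)
qed

text \<open>Split each row sum along the clusters. On a cluster the value of \<open>h\<close>
  factors out, and what remains is a sum that common influence makes equal for both rows.\<close>

lemma common_influence_cluster_constant:
  fixes A :: "real ^ 'n::finite ^ 'n"
  assumes C: "clustering K C" and A: "common_influence K C A" and h: "cluster_constant K C h"
  shows "cluster_constant K C (A *v h)"
  unfolding cluster_constant_def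
proof (intro ballI)
  fix p i i' assume p: "p \<in> {1..K}" and i: "i \<in> C p" "i' \<in> C p"
  have UN: "(UNIV :: 'n set) = (\<Union>q\<in>{1..K}. C q)" using clustering_ex[OF C] by auto
  have split: "(A *v h) $ k = (\<Sum>q\<in>{1..K}. \<Sum>j\<in>C q. A $ k $ j * h $ j)" for k
    unfolding matrix_vector_mult_nth UN
    by (rule sum.UNION_disjoint) (use clustering_unique[OF C] in auto)
  have "(\<Sum>j\<in>C q. A $ i $ j * h $ j) = (\<Sum>j\<in>C q. A $ i' $ j * h $ j)" if q: "q \<in> {1..K}" for q
  proof -
    obtain a where "\<And>j. j \<in> C q \<Longrightarrow> h $ j = a"
      using h q unfolding cluster_constant_def by metis
    moreover have "(\<Sum>j\<in>C q. A $ i $ j) = (\<Sum>j\<in>C q. A $ i' $ j)"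
      using A p q i unfolding common_influence_def by metis
    ultimately show ?thesis by (simp flip: sum_distrib_right)
  qed
  then show "(A *v h) $ i = (A *v h) $ i'" unfolding split by (rule sum.cong[OF refl])
qed

lemma mat_power_cluster_constant:
  assumes "clustering K C" "common_influence K C A" "cluster_constant K C h"
  shows "cluster_constant K C (mat_power A k *v h)"
proof (induction k)
  case 0
  then show ?case using assms by simp
next
  case (Suc k)
  then show ?case using common_influence_cluster_constant[OF assms(1,2)]
    by (simp only: mat_power_Suc_mult)
qed

text \<open>A cluster-constant part of \<open>h\<close> can be subtracted; what remains has values in \<open>[0, D]\<close>, and
  the shared weight \<open>\<delta>\<close> on \<open>v\<close> contributes equally to all rows of the cluster.\<close>

lemma cluster_diameter_contraction:
  fixes M :: "real ^ 'n::finite ^ 'n"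
  assumes C: "clustering K C" and M: "stochastic_matrix M"
    and pres: "\<And>g. cluster_constant K C g \<Longrightarrow> cluster_constant K C (M *v g)"
    and \<delta>: "\<And>p. p \<in> {1..K} \<Longrightarrow> \<exists>v. \<forall>i\<in>C p. M $ i $ v \<ge> \<delta>"
    and h: "cluster_diameter_le K C h D"
  shows "cluster_diameter_le K C (M *v h) ((1 - \<delta>) * D)"
proof -
  obtain g :: "real ^ 'n" where g: "\<And>p i. p \<in> {1..K} \<Longrightarrow> i \<in> C p \<Longrightarrow> g $ i = Min ((\<lambda>j. h $ j) ` C p)"
    using clustering_vector[OF C, of "\<lambda>p. Min ((\<lambda>j. h $ j) ` C p)"] by auto
  define r where "r = h - g"
  have r: "0 \<le> r $ j" "r $ j \<le> D" for j
  proof -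
    obtain p where p: "p \<in> {1..K}" "j \<in> C p" using clustering_ex[OF C] by blast
    have "Min ((\<lambda>j. h $ j) ` C p) \<in> (\<lambda>j. h $ j) ` C p" using p by (intro Min_in) auto
    then obtain j' where "j' \<in> C p" "g $ j = h $ j'" using g[OF p] by auto
    then have "\<bar>h $ j - g $ j\<bar> \<le> D" using h p unfolding cluster_diameter_le_def by auto
    moreover have "g $ j \<le> h $ j" using g[OF p] p by simp
    ultimately show "0 \<le> r $ j" "r $ j \<le> D" by (auto simp: r_def)
  qed
  have "cluster_constant K C g" unfolding cluster_constant_def using g by auto
  then have Mg: "cluster_constant K C (M *v g)" by (rule pres)
  have Mh: "M *v h = M *v g + M *v r" by (simp add: r_def matrix_vector_mult_diff_distrib)
  show ?thesis
    unfolding cluster_diameter_le_def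
  proof (intro ballI)
    fix p i i' assume p: "p \<in> {1..K}" and i: "i \<in> C p" "i' \<in> C p"
    obtain v where v: "\<And>i. i \<in> C p \<Longrightarrow> M $ i $ v \<ge> \<delta>" using \<delta>[OF p] by blast
    have range: "0 \<le> (M *v r) $ k - \<delta> * r $ v \<and> (M *v r) $ k - \<delta> * r $ v \<le> (1 - \<delta>) * D"
      if k: "k \<in> C p" for k
    proof -
      \<comment> \<open>Row \<open>k\<close> with the shared weight \<open>\<delta>\<close> removed
        from column \<open>v\<close>: still nonnegative, with row sum
        \<open>1 - \<delta>\<close>.\<close>
      define e where "e j = M $ k $ j - (if j = v then \<delta> else 0)" for j
      have e: "e j \<ge> 0" for j
        using v[OF k] stochastic_matrix_nonneg[OF M] by (simp add: e_def)
      have "(M *v r) $ k - \<delta> * r $ v = (\<Sum>j\<in>UNIV. e j * r $ j)"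
      proof -
        have "e j * r $ j = M $ k $ j * r $ j - (if j = v then \<delta> * r $ v else 0)" for j
          by (simp add: e_def left_diff_distrib)
        then show ?thesis by (simp add: matrix_vector_mult_nth sum_subtractf)
      qed
      moreover have "(\<Sum>j\<in>UNIV. e j * r $ j) \<le> (\<Sum>j\<in>UNIV. e j * D)"
        by (intro sum_mono mult_left_mono r e)
      moreover have "(\<Sum>j\<in>UNIV. e j * r $ j) \<ge> 0"
        by (intro sum_nonneg mult_nonneg_nonneg r e)
      moreover have "(\<Sum>j\<in>UNIV. e j) = 1 - \<delta>"
        using stochastic_matrix_row_sum[OF M] by (simp add: e_def sum_subtractf)
      ultimately show ?thesis by (simp flip: sum_distrib_right)
    qed
    have "(M *v g) $ i = (M *v g) $ i'" using Mg p i unfolding cluster_constant_def by blast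
    then show "\<bar>(M *v h) $ i - (M *v h) $ i'\<bar> \<le> (1 - \<delta>) * D"
      using range[OF i(1)] range[OF i(2)] by (simp add: Mh abs_le_iff)
  qed
qed

section \<open>Positive columns of matrix powers and decay of the cluster diameter\<close>

lemma mat_power_pos_of_edge:
  assumes A: "stochastic_matrix A" and "A $ i $ j > 0" and "mat_power A k $ j $ v > 0"
  shows "mat_power A (Suc k) $ i $ v > 0"
proof -
  have "0 < A $ i $ j * mat_power A k $ j $ v" using assms by simp
  also have "\<dots> \<le> (\<Sum>l\<in>UNIV. A $ i $ l * mat_power A k $ l $ v)"
    using stochastic_matrix_nonneg[OF A] stochastic_matrix_nonneg[OF stochastic_mat_power[OF A]]
    by (intro member_le_sum) auto
  finally show ?thesis by (simp add: matrix_matrix_mult_def)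
qed

text \<open>Following a path makes the entry positive for some exponent. The self-loops from the
  positive diagonal then keep it positive for all larger exponents.\<close>

lemma eventually_mat_power_pos:
  assumes A: "stochastic_matrix A" and diag: "\<And>i. A $ i $ i > 0"
    and "(v, w) \<in> (matrix_graph A)\<^sup>*"
  shows "\<forall>\<^sub>F k in sequentially. mat_power A k $ w $ v > 0"
proof -
  have "\<exists>k. mat_power A k $ w $ v > 0"
    using assms(3)
  proof (induction rule: rtrancl_induct)
    case base
    have "mat_power A 0 $ v $ v > 0" by (simp add: mat_def)
    then show ?case by blast
  next
    case (step y z)
    then have "A $ z $ y > 0" by (simp add: matrix_graph_def)
    with step.IH show ?case using mat_power_pos_of_edge[OF A] by blast
  qed
  then obtain k where k: "mat_power A k $ w $ v > 0" by blast
  have "mat_power A l $ w $ v > 0" if "k \<le> l" for l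
    using that by (induction l rule: dec_induct) (use k mat_power_pos_of_edge[OF A diag] in auto)
  then show ?thesis unfolding eventually_sequentially by blast
qed

text \<open>Positivity holds eventually for each of the finitely many reachable pairs, so a single
  exponent \<open>m\<close> serves all of them. The column for a cluster is that of its
  root.\<close>

lemma mat_power_common_column:
  fixes A :: "real ^ 'n::finite ^ 'n"
  assumes A: "stochastic_matrix A" and diag: "\<And>i. A $ i $ i > 0"
    and tree: "cluster_spanning_trees K C (matrix_graph A)"
  obtains \<delta> m where "0 < \<delta>" "\<delta> < 1"
    "\<And>p. p \<in> {1..K} \<Longrightarrow> \<exists>v. \<forall>i\<in>C p. mat_power A m $ i $ v \<ge> \<delta>"
proof -
  have "\<forall>\<^sub>F k in sequentially. \<forall>e\<in>(matrix_graph A)\<^sup>*. mat_power A k $ snd e $ fst e > 0"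
    by (intro eventually_ball_finite) (auto intro: eventually_mat_power_pos[OF A diag])
  then obtain m where m: "\<And>v w. (v, w) \<in> (matrix_graph A)\<^sup>* \<Longrightarrow> mat_power A m $ w $ v > 0"
    unfolding eventually_sequentially by fastforce
  \<comment> \<open>A minimum of finitely many positive numbers is positive; the extra member 1/2
    keeps it below 1.\<close>
  define \<delta> where "\<delta> = Min (insert (1/2) ((\<lambda>(v, w). mat_power A m $ w $ v) ` (matrix_graph A)\<^sup>*))"
  have "0 < \<delta>" using m by (auto simp: \<delta>_def)
  moreover have "\<delta> \<le> 1/2" unfolding \<delta>_def by (rule Min_le) auto
  moreover have "\<exists>v. \<forall>i\<in>C p. mat_power A m $ i $ v \<ge> \<delta>" if p: "p \<in> {1..K}" for p
  proof -
    obtain v where v: "\<And>w. w \<in> C p \<Longrightarrow> (v, w) \<in> (matrix_graph A)\<^sup>*"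
      using tree p unfolding cluster_spanning_trees_def by blast
    have "\<delta> \<le> mat_power A m $ w $ v" if "w \<in> C p" for w
      unfolding \<delta>_def by (rule Min_le) (use v[OF that] in force)+
    then show ?thesis by blast
  qed
  ultimately show thesis using that[of \<delta> m] by simp
qed

text \<open>Driven and free motion from a common state differ by a cluster-constant vector, so any
  diameter bound passes from one to the other. The free motion shrinks the diameter by
  \<open>1 - \<delta>\<close> every \<open>m\<close> steps.\<close>

lemma driven_system_synchronizes:
  fixes A :: "real ^ 'n::finite ^ 'n"
  assumes C: "clustering K C" and A: "stochastic_matrix A" and diag: "\<And>i. A $ i $ i > 0"
    and inf: "common_influence K C A" and tree: "cluster_spanning_trees K C (matrix_graph A)"
    and x: "\<And>t. x (Suc t) = A *v x t + I t" and I: "\<And>t. cluster_constant K C (I t)"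
  shows "intra_cluster_synchronizes K C x"
proof -
  obtain m \<delta> where \<delta>: "0 < \<delta>" "\<delta> < 1"
    and col: "\<And>p. p \<in> {1..K} \<Longrightarrow> \<exists>v. \<forall>i\<in>C p. mat_power A m $ i $ v \<ge> \<delta>"
    by (rule mat_power_common_column[OF A diag tree]) (rule that)
  have dev: "cluster_constant K C (x (t + k) - mat_power A k *v x t)" for t k
  proof (induction k)
    case 0
    then show ?case by (simp add: cluster_constant_def)
  next
    case (Suc k)
    have "x (t + Suc k) - mat_power A (Suc k) *v x t
        = A *v (x (t + k) - mat_power A k *v x t) + I (t + k)"
      by (simp only: x add_Suc_right mat_power_Suc_mult matrix_vector_mult_diff_distrib) simp
    then show ?case
      by (simp only:) (intro cluster_constant_add common_influence_cluster_constant[OF C inf Suc] I)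
  qed
  have step: "cluster_diameter_le K C (x (t + k)) D" if "cluster_diameter_le K C (mat_power A k *v x t) D"
    for t k D
    using cluster_diameter_le_add_cluster_constant[OF that dev[of t k]] by simp
  obtain D where D: "cluster_diameter_le K C (x 0) D"
  proof
    show "cluster_diameter_le K C (x 0) (2 * infnorm (x 0))"
      unfolding cluster_diameter_le_def
    proof (intro ballI)
      fix i i'
      show "\<bar>x 0 $ i - x 0 $ i'\<bar> \<le> 2 * infnorm (x 0)"
        using component_le_infnorm_cart[of "x 0" i] component_le_infnorm_cart[of "x 0" i'] by linarith
    qed
  qed
  have main: "cluster_diameter_le K C (x t) ((1 - \<delta>) ^ k * D)" if "k * m \<le> t" for k t
    using that
  proof (induction k arbitrary: t)
    case 0
    \<comment> \<open>With weight 0 the contraction lemma says that diameters do not grow. This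
      covers the times that are not multiples of \<open>m\<close>.\<close>
    have "cluster_diameter_le K C (mat_power A t *v x 0) ((1 - 0) * D)"
      by (rule cluster_diameter_contraction[OF C stochastic_mat_power[OF A]
            mat_power_cluster_constant[OF C inf] _ D])
        (auto intro: stochastic_matrix_nonneg[OF stochastic_mat_power[OF A]])
    then show ?case using step[of t 0 D] by simp
  next
    case (Suc k)
    then have IH: "cluster_diameter_le K C (x (t - m)) ((1 - \<delta>) ^ k * D)" by simp
    have "cluster_diameter_le K C (mat_power A m *v x (t - m)) ((1 - \<delta>) * ((1 - \<delta>) ^ k * D))"
      by (rule cluster_diameter_contraction[OF C stochastic_mat_power[OF A]
            mat_power_cluster_constant[OF C inf] col IH])
    then show ?case using step[of m "t - m"] Suc.prems by (simp add: mult.assoc)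
  qed
  show ?thesis
    unfolding intra_cluster_synchronizes_def
  proof (intro ballI)
    fix p i i' assume p: "p \<in> {1..K}" "i \<in> C p" "i' \<in> C p"
    have lim: "(\<lambda>k. (1 - \<delta>) ^ k * D) \<longlonglongrightarrow> 0"
      using \<delta> by (intro tendsto_mult_left_zero LIMSEQ_power_zero) simp
    show "(\<lambda>t. \<bar>x t $ i - x t $ i'\<bar>) \<longlonglongrightarrow> 0"
    proof (rule LIMSEQ_I)
      fix \<epsilon> :: real assume "\<epsilon> > 0"
      then have "\<forall>\<^sub>F k in sequentially. (1 - \<delta>) ^ k * D < \<epsilon>" by (rule order_tendstoD(2)[OF lim])
      then obtain k where k: "(1 - \<delta>) ^ k * D < \<epsilon>" by (auto simp: eventually_sequentially)
      have "\<bar>x t $ i - x t $ i'\<bar> < \<epsilon>" if "k * m \<le> t" for t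
        using main[OF that] p k unfolding cluster_diameter_le_def by fastforce
      then show "\<exists>no. \<forall>t\<ge>no. norm (\<bar>x t $ i - x t $ i'\<bar> - 0) < \<epsilon>" by auto
    qed
  qed
qed

theorem theorem1:
  fixes A :: "real ^ 'n::finite ^ 'n"
    and K :: nat
    and C :: "nat \<Rightarrow> 'n set"
    and \<alpha> :: "nat \<Rightarrow> real"
    and u :: "nat \<Rightarrow> real"
    and I x :: "nat \<Rightarrow> real ^ 'n"
  assumes "clustering K C"
    and "stochastic_matrix A"
    and "common_influence K C A"
    and "cluster_spanning_trees K C (matrix_graph A)"
    and "\<And>i. A $ i $ i > 0"
    and "inj_on \<alpha> {1..K}"
    and "bounded (range u)"
    and "bounded (range (\<lambda>t. \<Sum>k=1..t. u k))"
    and "\<And>t p i. p \<in> {1..K} \<Longrightarrow> i \<in> C p \<Longrightarrow> I t $ i = \<alpha> p * u t"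
    and "\<And>t i. x (t + 1) $ i = (\<Sum>j\<in>UNIV. A $ i $ j * x t $ j) + I t $ i"
  shows "bounded (range x) \<and> intra_cluster_synchronizes K C x"
proof
  have x: "x (Suc t) = A *v x t + I t" for t
    using assms(10)[of t] by (simp add: vec_eq_iff matrix_vector_mult_nth)
  have "cluster_constant K C (I t)" for t
    using assms(9) by (simp add: cluster_constant_def)
  then show "intra_cluster_synchronizes K C x"
    by (rule driven_system_synchronizes[OF assms(1,2,5,3,4), of x I, OF x])
  obtain \<zeta> :: "real ^ 'n" where \<zeta>: "\<And>p i. p \<in> {1..K} \<Longrightarrow> i \<in> C p \<Longrightarrow> \<zeta> $ i = \<alpha> p"
    using clustering_vector[OF assms(1), of \<alpha>] by auto
  have "I t $ i = (u t *\<^sub>R \<zeta>) $ i" for t i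
    using clustering_ex[OF assms(1), of i] assms(9) \<zeta> by auto
  then have x': "x (Suc t) = A *v x t + u t *\<^sub>R \<zeta>" for t
    by (simp add: x vec_eq_iff)
  obtain U where U: "\<And>t. \<bar>u t\<bar> \<le> U" using assms(7) by (auto simp: bounded_iff)
  obtain V where V: "\<And>t. \<bar>\<Sum>k=1..t. u k\<bar> \<le> V" using assms(8) by (auto simp: bounded_iff)
  \<comment> \<open>The hypothesis sums \<open>u\<close> from 1 to \<open>t\<close>, whereas the
    state at time \<open>t\<close> has received the inputs 0 to \<open>t - 1\<close>. The extra term
    \<open>u 0\<close> is absorbed by \<open>U\<close>.\<close>
  have "\<bar>\<Sum>k<t. u k\<bar> \<le> U + V" for t
  proof (cases t)
    case 0
    then show ?thesis using U[of 0] V[of 0] by simp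
  next
    case (Suc n)
    have "(\<Sum>k<t. u k) = u 0 + (\<Sum>k=1..n. u k)"
      by (simp add: Suc lessThan_Suc_atMost atMost_atLeast0 sum.atLeast_Suc_atMost)
    then show ?thesis using U[of 0] V[of n] by linarith
  qed
  then have "bounded (range (\<lambda>t. \<Sum>k<t. u k))" unfolding bounded_iff by auto
  then show "bounded (range x)"
    by (intro driven_system_bounded[OF assms(2,5,7), of x \<zeta>] x')
qed

end
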